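(* Let $e:\left(\mathcal{C}^\infty(\mathbb{R}^n)\right)^4\to\mathcal{C}^\infty(\mathbb{R}^n)$ be a four-linear function. Then $e$ has the four properties (i) $e$ is a derivation in each of the four arguments, (ii) $e$ is symmetric in the third and fourth argument, (iii) $e(h,\cdot,h,h)\equiv 0$ for all $h\in\mathcal{C}^\infty(\mathbb{R}^n)$, (iv) $e(\cdot,\cdot,h,h)$ is pointwise symmetric and positive semidefinite for all $h\in\mathcal{C}^\infty(\mathbb{R}^n)$, if, and only if, there is some $\varepsilon\in\mathcal{C}^\infty(\mathbb{R}^n,\mathbb{R}^{n\times n\times n\times n})$ such that, for all $i,j,k,\ell\in\{1,\ldots,n\}$, (a) $\varepsilon_{i,j,k,\ell}=\varepsilon_{i,j,\ell,k}$, (b) $\varepsilon_{i,j,k,\ell}+\varepsilon_{k,j,\ell,i}+\varepsilon_{\ell,j,i,k}=0$, and (c) for every $h\in\mathcal{C}^\infty(\mathbb{R}^n)$ the matrix-valued function $\left[\sum_{k,\ell=1}^n\varepsilon_{i,j,k,\ell}\,\mathrm{d}_kh\,\mathrm{d}_\ell h\right]_{i,j=1}^n$ is pointwise symmetric and positive semidefinite, and such that $$e(f,s,h,q)=\sum_{i,j,k,\ell=1}^n\varepsilon_{i,j,k,\ell}\,\mathrm{d}_if\,\mathrm{d}_js\,\mathrm{d}_kh\,\mathrm{d}_\ell q\qquad\text{for all } f,s,h,q\in\mathcal{C}^\infty(\mathbb{R}^n).$$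
   Context: $\mathcal{C}^\infty(\mathbb{R}^n)$ is the algebra of smooth real-valued functions on $\mathbb{R}^n$; $\mathrm{d}_if$ denotes the $i$-th partial derivative of $f$ in standard coordinates. Four-linear means $\mathbb{R}$-linear in each of the four arguments. A derivation is a linear map $\delta:\mathcal{C}^\infty(\mathbb{R}^n)\to\mathcal{C}^\infty(\mathbb{R}^n)$ with $\delta(fg)=f\delta(g)+\delta(f)g$ for all $f,g\in\mathcal{C}^\infty(\mathbb{R}^n)$. Property (iv) means: $e(f,s,h,h)=e(s,f,h,h)$ and $e(f,f,h,h)(x)\geq 0$ for all $f,s,h\in\mathcal{C}^\infty(\mathbb{R}^n)$ and $x\in\mathbb{R}^n$. Property (iii) means $e(h,s,h,h)=0$ for all $s,h\in\mathcal{C}^\infty(\mathbb{R}^n)$. *)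

theory Defs
  imports "HOL-Analysis.Analysis"
begin

definition partial_deriv :: "'n::finite \<Rightarrow> (real ^ 'n \<Rightarrow> 'b::real_normed_vector) \<Rightarrow> real ^ 'n \<Rightarrow> 'b"
  where "partial_deriv i f x = vector_derivative (\<lambda>t. f (x + t *\<^sub>R axis i 1)) (at 0)"

(* The differentiability conjunct guarantees that the partial derivatives exist;
   vector_derivative is an unspecified value where there is no derivative. *)
primrec Ck :: "nat \<Rightarrow> (real ^ 'n::finite \<Rightarrow> 'b::real_normed_vector) \<Rightarrow> bool"
  where
    "Ck 0 f \<longleftrightarrow> continuous_on UNIV f"
  | "Ck (Suc k) f \<longleftrightarrow> f differentiable_on UNIV \<and> (\<forall>i. Ck k (partial_deriv i f))"

definition Cinf :: "(real ^ 'n::finite \<Rightarrow> 'b::real_normed_vector) set"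
  where "Cinf = {f. \<forall>k. Ck k f}"

type_synonym 'n scalar_fun = "real ^ 'n \<Rightarrow> real"

(* Operators on smooth functions are HOL functions on all of 'n scalar_fun;
   only their values on Cinf matter, and every condition below is restricted to Cinf. *)

definition linear_on_Cinf :: "('n::finite scalar_fun \<Rightarrow> 'n scalar_fun) \<Rightarrow> bool"
  where "linear_on_Cinf T \<longleftrightarrow>
    (\<forall>f\<in>Cinf. T f \<in> Cinf) \<and>
    (\<forall>f\<in>Cinf. \<forall>g\<in>Cinf. T (\<lambda>x. f x + g x) = (\<lambda>x. T f x + T g x)) \<and>
    (\<forall>c. \<forall>f\<in>Cinf. T (\<lambda>x. c * f x) = (\<lambda>x. c * T f x))"

definition derivation_on_Cinf :: "('n::finite scalar_fun \<Rightarrow> 'n scalar_fun) \<Rightarrow> bool"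
  where "derivation_on_Cinf \<delta> \<longleftrightarrow>
    linear_on_Cinf \<delta> \<and>
    (\<forall>f\<in>Cinf. \<forall>g\<in>Cinf. \<delta> (\<lambda>x. f x * g x) = (\<lambda>x. f x * \<delta> g x + \<delta> f x * g x))"

type_synonym 'n four_map =
  "'n scalar_fun \<Rightarrow> 'n scalar_fun \<Rightarrow> 'n scalar_fun \<Rightarrow> 'n scalar_fun \<Rightarrow> 'n scalar_fun"

definition in_each_argument ::
  "(('n::finite scalar_fun \<Rightarrow> 'n scalar_fun) \<Rightarrow> bool) \<Rightarrow> 'n four_map \<Rightarrow> bool"
  where "in_each_argument P e \<longleftrightarrow>
    (\<forall>a\<in>Cinf. \<forall>b\<in>Cinf. \<forall>c\<in>Cinf.
       P (\<lambda>u. e u a b c) \<and> P (\<lambda>u. e a u b c) \<and> P (\<lambda>u. e a b u c) \<and> P (\<lambda>u. e a b c u))"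

definition four_linear :: "'n::finite four_map \<Rightarrow> bool"
  where "four_linear e \<longleftrightarrow> in_each_argument linear_on_Cinf e"

definition four_derivation :: "'n::finite four_map \<Rightarrow> bool"
  where "four_derivation e \<longleftrightarrow> in_each_argument derivation_on_Cinf e"

definition symmetric_matrix :: "real ^ 'n ^ 'n \<Rightarrow> bool"
  where "symmetric_matrix A \<longleftrightarrow> transpose A = A"

definition pos_semidef_matrix :: "real ^ 'n::finite ^ 'n \<Rightarrow> bool"
  where "pos_semidef_matrix A \<longleftrightarrow> (\<forall>v. v \<bullet> (A *v v) \<ge> 0)"

end

theory Submission
  imports Defs
begin

text \<open>By Hadamard's lemma a smooth \<open>f\<close> is \<open>f(a) + \<Sum>\<^sub>i (x\<^sub>i - a\<^sub>i) g\<^sub>i(x)\<close> with \<open>g\<^sub>i\<close> smooth and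
  \<open>g\<^sub>i(a) = d\<^sub>i f(a)\<close>, so a derivation is determined by its values on the coordinate functions.
  Applied in each argument, this yields the formula for \<open>e\<close> with \<open>\<epsilon>\<^sub>i\<^sub>j\<^sub>k\<^sub>l = e(x\<^sub>i, x\<^sub>j, x\<^sub>k, x\<^sub>l)\<close>.
  The remaining conditions can then be compared pointwise: linear functions realise every vector as
  a gradient, and polarization of the cubic form in (iii) gives (b).\<close>

section \<open>Partial derivatives of differentiable functions\<close>

text \<open>Chain rule along the line t \<mapsto> x + t \<open>axis i 1\<close>. All rules for
  \<open>partial_deriv\<close> below are read off from the rules for Frechet derivatives in this
  way.\<close>

lemma partial_deriv_eq:
  assumes "(f has_derivative f') (at x)"
  shows "partial_deriv i f x = f' (axis i 1)"
proof -
  have "((\<lambda>t. x + t *\<^sub>R axis i 1) has_vector_derivative axis i 1) (at 0)"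
    by (auto intro!: derivative_eq_intros simp: has_vector_derivative_def)
  moreover have "(f has_derivative f') (at (x + 0 *\<^sub>R axis i 1))"
    using assms by simp
  ultimately have "((f \<circ> (\<lambda>t. x + t *\<^sub>R axis i 1)) has_vector_derivative f' (axis i 1)) (at 0)"
    by (rule vector_derivative_diff_chain_within[of _ _ _ UNIV, simplified, OF _ has_derivative_at_withinI])
  then show ?thesis
    unfolding partial_deriv_def by (simp add: vector_derivative_at o_def)
qed

text \<open>The Frechet derivative is linear, so it is determined by its values on the standard
  basis, which are the partial derivatives.\<close>

lemma has_derivative_partial_deriv:
  fixes f :: "real ^ 'n::finite \<Rightarrow> 'b::real_normed_vector"
  assumes "f differentiable (at x)"
  shows "(f has_derivative (\<lambda>v. \<Sum>i\<in>UNIV. v $ i *\<^sub>R partial_deriv i f x)) (at x)"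
proof -
  obtain f' where f': "(f has_derivative f') (at x)"
    using assms by (auto simp: differentiable_def)
  then interpret f': bounded_linear f' by (rule has_derivative_bounded_linear)
  have "f' v = (\<Sum>i\<in>UNIV. v $ i *\<^sub>R partial_deriv i f x)" for v
  proof -
    have "f' v = f' (\<Sum>i\<in>UNIV. v $ i *\<^sub>R axis i 1)"
      by (simp add: basis_expansion flip: scalar_mult_eq_scaleR)
    then show ?thesis
      by (simp add: f'.sum f'.scaleR partial_deriv_eq[OF f'])
  qed
  then have "f' = (\<lambda>v. \<Sum>i\<in>UNIV. v $ i *\<^sub>R partial_deriv i f x)" ..
  with f' show ?thesis by simp
qed

lemma partial_deriv_bounded_linear:
  assumes "bounded_linear L" "f differentiable (at x)"
  shows "partial_deriv i (\<lambda>x. L (f x)) x = L (partial_deriv i f x)"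
proof -
  obtain f' where f': "(f has_derivative f') (at x)"
    using assms by (auto simp: differentiable_def)
  show ?thesis
    using partial_deriv_eq[OF f'] partial_deriv_eq[OF bounded_linear.has_derivative[OF assms(1) f']]
    by simp
qed

lemma partial_deriv_add:
  assumes "f differentiable (at x)" "g differentiable (at x)"
  shows "partial_deriv i (\<lambda>x. f x + g x) x = partial_deriv i f x + partial_deriv i g x"
proof -
  obtain f' g' where "(f has_derivative f') (at x)" "(g has_derivative g') (at x)"
    using assms by (auto simp: differentiable_def)
  then show ?thesis
    by (simp add: partial_deriv_eq[OF has_derivative_add] partial_deriv_eq)
qed

lemma partial_deriv_mult:
  fixes f g :: "real ^ 'n::finite \<Rightarrow> real"
  assumes "f differentiable (at x)" "g differentiable (at x)"
  shows "partial_deriv i (\<lambda>x. f x * g x) x = f x * partial_deriv i g x + partial_deriv i f x * g x"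
proof -
  obtain f' g' where "(f has_derivative f') (at x)" "(g has_derivative g') (at x)"
    using assms by (auto simp: differentiable_def)
  then show ?thesis
    by (simp add: partial_deriv_eq[OF has_derivative_mult] partial_deriv_eq)
qed

lemma partial_deriv_const [simp]: "partial_deriv i (\<lambda>x. c) = (\<lambda>x. 0)"
  by (rule ext) (simp add: partial_deriv_eq[OF has_derivative_const])

lemma partial_deriv_linear:
  assumes "bounded_linear f"
  shows "partial_deriv i f = (\<lambda>x. f (axis i 1))"
  by (rule ext) (rule partial_deriv_eq[OF bounded_linear_imp_has_derivative[OF assms]])

section \<open>Smooth functions and their closure properties\<close>

text \<open>Any family of differentiable functions that is stable under partial derivatives is
  smooth, by induction on the order for all members at once. Smoothness can thus be shown without
  computing higher derivatives.\<close>

lemma Cinf_coinduct: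
  assumes "f \<in> S"
    and diff: "\<And>g. g \<in> S \<Longrightarrow> g differentiable_on UNIV"
    and closed: "\<And>g i. g \<in> S \<Longrightarrow> partial_deriv i g \<in> S"
  shows "f \<in> Cinf"
proof -
  have "Ck k g" if "g \<in> S" for k g
    using that
    by (induction k arbitrary: g) (auto simp: diff closed differentiable_imp_continuous_on)
  with \<open>f \<in> S\<close> show ?thesis by (simp add: Cinf_def)
qed

lemma Ck_Suc_imp_Ck: "Ck (Suc k) f \<Longrightarrow> Ck k f"
proof (induction k arbitrary: f)
  case 0
  then show ?case by (simp add: differentiable_imp_continuous_on)
next
  case (Suc k)
  then show ?case using Ck.simps(2) by blast
qed

lemma Cinf_differentiable: "f \<in> Cinf \<Longrightarrow> f differentiable (at x)"
  by (auto simp: Cinf_def differentiable_on_def dest: spec[of _ "Suc 0"])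

lemma Cinf_partial_deriv: "f \<in> Cinf \<Longrightarrow> partial_deriv i f \<in> Cinf"
  unfolding Cinf_def mem_Collect_eq by (metis Ck.simps(2))

lemma Cinf_continuous_on: "f \<in> Cinf \<Longrightarrow> continuous_on A f"
  by (rule continuous_on_subset[of UNIV]) (auto simp: Cinf_def dest: spec[of _ 0])

lemma Ck_add: "Ck k f \<Longrightarrow> Ck k g \<Longrightarrow> Ck k (\<lambda>x. f x + g x)"
proof (induction k arbitrary: f g)
  case (Suc k)
  then have "partial_deriv i (\<lambda>x. f x + g x) = (\<lambda>x. partial_deriv i f x + partial_deriv i g x)" for i
    by (intro ext partial_deriv_add) (auto simp: differentiable_on_def)
  with Suc show ?case by (auto intro: differentiable_on_add)
qed (auto intro: continuous_on_add)

lemma Ck_mult: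
  fixes f g :: "real ^ 'n::finite \<Rightarrow> real"
  shows "Ck k f \<Longrightarrow> Ck k g \<Longrightarrow> Ck k (\<lambda>x. f x * g x)"
proof (induction k arbitrary: f g)
  case (Suc k)
  then have "partial_deriv i (\<lambda>x. f x * g x)
      = (\<lambda>x. f x * partial_deriv i g x + partial_deriv i f x * g x)" for i
    by (intro ext partial_deriv_mult) (auto simp: differentiable_on_def)
  \<comment> \<open>The product rule leaves one factor undifferentiated in each term, so the order
    of \<open>f\<close> and \<open>g\<close> has to be lowered to \<open>k\<close> before the
    induction hypothesis applies.\<close>
  moreover have "Ck k f" "Ck k g" using Suc.prems by (auto intro: Ck_Suc_imp_Ck simp del: Ck.simps)
  ultimately show ?case
    using Suc by (auto intro!: differentiable_on_mult Ck_add)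
qed (auto intro: continuous_on_mult)

lemma Ck_bounded_linear:
  assumes "bounded_linear L"
  shows "Ck k f \<Longrightarrow> Ck k (\<lambda>x. L (f x))"
proof (induction k arbitrary: f)
  case 0
  then show ?case by (simp add: bounded_linear.continuous_on[OF assms])
next
  case (Suc k)
  then have "partial_deriv i (\<lambda>x. L (f x)) = (\<lambda>x. L (partial_deriv i f x))" for i
    by (intro ext partial_deriv_bounded_linear[OF assms]) (auto simp: differentiable_on_def)
  moreover have "(\<lambda>x. L (f x)) differentiable_on UNIV"
    using Suc.prems by (auto simp: differentiable_on_def
        intro!: bounded_linear_imp_differentiable[OF assms] differentiable_compose[of L])
  ultimately show ?case using Suc by simp
qed

lemma Cinf_add: "f \<in> Cinf \<Longrightarrow> g \<in> Cinf \<Longrightarrow> (\<lambda>x. f x + g x) \<in> Cinf"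
  by (simp add: Cinf_def Ck_add)

lemma Cinf_mult:
  fixes f g :: "real ^ 'n::finite \<Rightarrow> real"
  shows "f \<in> Cinf \<Longrightarrow> g \<in> Cinf \<Longrightarrow> (\<lambda>x. f x * g x) \<in> Cinf"
  by (simp add: Cinf_def Ck_mult)

lemma Cinf_bounded_linear_comp: "bounded_linear L \<Longrightarrow> f \<in> Cinf \<Longrightarrow> (\<lambda>x. L (f x)) \<in> Cinf"
  by (simp add: Cinf_def Ck_bounded_linear)

lemma Cinf_const: "(\<lambda>x. c) \<in> Cinf"
  by (rule Cinf_coinduct[where S = "range (\<lambda>c x. c)"]) auto

lemma Cinf_id: "(\<lambda>x. x) \<in> Cinf"
\<comment> \<open>The partial derivatives of the identity are constants, already known to be smooth,
  so adjoining the identity to \<open>Cinf\<close> gives a stable family.\<close>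
proof (rule Cinf_coinduct[where S = "insert (\<lambda>x. x) Cinf"])
  fix g :: "real ^ 'n \<Rightarrow> real ^ 'n" and i :: 'n
  assume "g \<in> insert (\<lambda>x. x) Cinf"
  then show "partial_deriv i g \<in> insert (\<lambda>x. x) Cinf"
    by (auto simp: Cinf_partial_deriv partial_deriv_linear Cinf_const)
qed (auto simp: differentiable_on_def Cinf_differentiable)

lemma Cinf_bounded_linear: "bounded_linear f \<Longrightarrow> f \<in> Cinf"
  by (rule Cinf_bounded_linear_comp[OF _ Cinf_id])

lemma Cinf_sum:
  assumes "\<And>i. i \<in> I \<Longrightarrow> f i \<in> Cinf"
  shows "(\<lambda>x. \<Sum>i\<in>I. f i x) \<in> Cinf"
  using assms by (induction I rule: infinite_finite_induct) (auto simp: Cinf_const Cinf_add)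

text \<open>The vector is the sum of its components embedded along the axes, and each embedding is
  bounded linear. Used four times in a row, this gives smoothness of a tensor field from that of its
  entries.\<close>

lemma Cinf_vec_lambda:
  fixes f :: "'m::finite \<Rightarrow> real ^ 'n::finite \<Rightarrow> 'b::real_normed_vector"
  assumes "\<And>i. f i \<in> Cinf"
  shows "(\<lambda>x. \<chi> i. f i x) \<in> Cinf"
proof -
  have "(\<lambda>x. \<chi> i. f i x) = (\<lambda>x. \<Sum>i\<in>UNIV. axis i (f i x))"
    by (auto simp: vec_eq_iff axis_def if_distrib cong: if_cong)
  moreover have "bounded_linear (axis i :: 'b \<Rightarrow> 'b ^ 'm)" for i
    by (rule bounded_linear_intro[where K = 1])
      (auto simp: vec_eq_iff axis_def norm_vec_def L2_set_def if_distrib[of norm] if_distrib[of "\<lambda>z. z\<^sup>2"] cong: if_cong)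
  ultimately show ?thesis
    by (simp add: Cinf_sum Cinf_bounded_linear_comp assms)
qed

section \<open>Hadamard's lemma\<close>

text \<open>The weights \<open>t ^ m\<close> make this family of integrals closed under partial derivatives, so that
  their smoothness follows by coinduction.\<close>

lemma has_derivative_segment_integral:
  fixes p :: "real ^ 'n::finite \<Rightarrow> real"
  assumes "p \<in> Cinf"
  shows "((\<lambda>x. integral {0..1} (\<lambda>t. t ^ m * p (a + t *\<^sub>R (x - a)))) has_derivative
    (\<lambda>v. \<Sum>i\<in>UNIV. v $ i * integral {0..1} (\<lambda>t. t ^ Suc m * partial_deriv i p (a + t *\<^sub>R (x - a)))))
    (at x)"
proof -
  define c where "c = (\<lambda>i x t. t ^ Suc m * partial_deriv i p (a + t *\<^sub>R (x - a)))"
  \<comment> \<open>\<open>B i\<close> is the functional v \<mapsto> \<open>v $ i\<close> as a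
    bounded linear map: \<open>leibniz_rule\<close> wants the derivative in this form, continuous in
    x and t jointly.\<close>
  define B where "B = (\<lambda>i. blinfun_inner_right (axis i 1 :: real ^ 'n))"
  \<comment> \<open>The domain type is left general because continuity is needed both in t alone and
    in the pair (x, t).\<close>
  have cont: "continuous_on A (\<lambda>z. q (h z))" if "q \<in> Cinf" "continuous_on A h"
    for q :: "real ^ 'n \<Rightarrow> real" and A :: "'c::topological_space set" and h
    using continuous_on_compose2[OF Cinf_continuous_on[OF that(1), of UNIV] that(2)] by simp
  note cont_partial = cont[OF Cinf_partial_deriv[OF assms]]
  have "((\<lambda>x. integral (cbox 0 1) (\<lambda>t. t ^ m * p (a + t *\<^sub>R (x - a)))) has_derivative
      integral (cbox 0 1) (\<lambda>t. \<Sum>i\<in>UNIV. c i x t *\<^sub>R B i)) (at x within UNIV)"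
  proof (rule leibniz_rule)
    fix x :: "real ^ 'n" and t :: real
    have "(p has_derivative (\<lambda>v. \<Sum>i\<in>UNIV. v $ i *\<^sub>R partial_deriv i p (a + t *\<^sub>R (x - a))))
        (at (a + t *\<^sub>R (x - a)))"
      by (intro has_derivative_partial_deriv Cinf_differentiable assms)
    moreover have "((\<lambda>x. a + t *\<^sub>R (x - a)) has_derivative (\<lambda>v. t *\<^sub>R v)) (at x)"
      by (auto intro!: derivative_eq_intros)
    ultimately have "((\<lambda>x. p (a + t *\<^sub>R (x - a))) has_derivative
        (\<lambda>v. \<Sum>i\<in>UNIV. (t *\<^sub>R v) $ i *\<^sub>R partial_deriv i p (a + t *\<^sub>R (x - a)))) (at x)"
      by (rule has_derivative_compose[rotated])
    from has_derivative_mult_right[OF this, of "t ^ m"]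
    show "((\<lambda>x. t ^ m * p (a + t *\<^sub>R (x - a))) has_derivative
        blinfun_apply (\<Sum>i\<in>UNIV. c i x t *\<^sub>R B i)) (at x within UNIV)"
      by (rule has_derivative_eq_rhs)
        (auto simp: fun_eq_iff blinfun.sum_left blinfun.scaleR_left c_def B_def inner_axis'
          sum_distrib_left mult_ac intro!: sum.cong)
  next
    show "(\<lambda>t. t ^ m * p (a + t *\<^sub>R (x - a))) integrable_on cbox 0 1" for x
      by (intro integrable_continuous continuous_intros cont[OF assms])
  next
    show "continuous_on (UNIV \<times> cbox 0 1) (\<lambda>(x, t). \<Sum>i\<in>UNIV. c i x t *\<^sub>R B i)"
      unfolding c_def case_prod_beta by (intro continuous_intros cont_partial)
  qed auto
  moreover have "integral (cbox 0 1) (\<lambda>t. \<Sum>i\<in>UNIV. c i x t *\<^sub>R B i)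
      = (\<Sum>i\<in>UNIV. integral {0..1} (c i x) *\<^sub>R B i)"
  proof (rule integral_unique, rule has_integral_sum)
    show "((\<lambda>t. c i x t *\<^sub>R B i) has_integral integral {0..1} (c i x) *\<^sub>R B i) (cbox 0 1)" for i
      unfolding c_def box_real
      by (intro has_integral_scaleR_left integrable_integral integrable_continuous_real
          continuous_intros cont_partial)
  qed simp
  moreover have "blinfun_apply (\<Sum>i\<in>UNIV. integral {0..1} (c i x) *\<^sub>R B i)
      = (\<lambda>v. \<Sum>i\<in>UNIV. v $ i * integral {0..1} (c i x))"
    by (simp add: fun_eq_iff blinfun.sum_left blinfun.scaleR_left B_def inner_axis' mult.commute)
  ultimately show ?thesis unfolding c_def by simp
qed

lemma Cinf_segment_integral:
  fixes p :: "real ^ 'n::finite \<Rightarrow> real"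
  assumes "p \<in> Cinf"
  shows "(\<lambda>x. integral {0..1} (\<lambda>t. p (a + t *\<^sub>R (x - a)))) \<in> Cinf"
proof (rule Cinf_coinduct)
  let ?S = "{\<lambda>x. integral {0..1} (\<lambda>t. t ^ m * q (a + t *\<^sub>R (x - a))) | m q.
    q \<in> (Cinf :: (real ^ 'n \<Rightarrow> real) set)}"
  show "(\<lambda>x. integral {0..1} (\<lambda>t. p (a + t *\<^sub>R (x - a)))) \<in> ?S"
    using assms by (auto intro!: exI[of _ 0] exI[of _ p])
  fix g assume "g \<in> ?S"
  then obtain m q where q: "q \<in> Cinf"
    and g: "g = (\<lambda>x. integral {0..1} (\<lambda>t. t ^ m * q (a + t *\<^sub>R (x - a))))" by blast
  note der = has_derivative_segment_integral[OF q, of m a, folded g]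
  show "g differentiable_on UNIV"
    using der by (auto simp: differentiable_on_def differentiable_def)
  have "partial_deriv i g
      = (\<lambda>x. integral {0..1} (\<lambda>t. t ^ Suc m * partial_deriv i q (a + t *\<^sub>R (x - a))))" for i
    by (rule ext) (simp add: partial_deriv_eq[OF der] axis_def mult_delta_left)
  then show "partial_deriv i g \<in> ?S" for i
    using Cinf_partial_deriv[OF q, of i] by blast
qed

text \<open>Integrating the derivative of \<open>f\<close> along the segment from \<open>a\<close>
  to x gives f(x) - f(a). The factors \<open>x $ i - a $ i\<close> do not depend on t and come out
  of the integral; what remains is g_i. At x = a the integrand is constant in t, which gives
  g_i(a).\<close>

lemma Hadamard:
  fixes f :: "real ^ 'n::finite \<Rightarrow> real"
  assumes "f \<in> Cinf"
  obtains g where "\<And>i. g i \<in> Cinf" "\<And>i. g i a = partial_deriv i f a"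
    "\<And>x. f x = f a + (\<Sum>i\<in>UNIV. (x $ i - a $ i) * g i x)"
proof
  let ?g = "\<lambda>i x. integral {0..1} (\<lambda>t. partial_deriv i f (a + t *\<^sub>R (x - a)))"
  note partial = Cinf_partial_deriv[OF assms]
  show "?g i \<in> Cinf" for i by (rule Cinf_segment_integral[OF partial])
  show "?g i a = partial_deriv i f a" for i by simp
  fix x
  have "((\<lambda>t. f (a + t *\<^sub>R (x - a))) has_vector_derivative
      (\<Sum>i\<in>UNIV. (x - a) $ i * partial_deriv i f (a + t *\<^sub>R (x - a)))) (at t within {0..1})" for t
  proof -
    have "((\<lambda>t. a + t *\<^sub>R (x - a)) has_derivative (\<lambda>s. s *\<^sub>R (x - a))) (at t within {0..1})"
      by (auto intro!: derivative_eq_intros)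
    from has_derivative_compose[OF this has_derivative_partial_deriv[OF Cinf_differentiable[OF assms]]]
    show ?thesis
      by (simp add: has_vector_derivative_def sum_distrib_left mult.assoc)
  qed
  then have "((\<lambda>t. \<Sum>i\<in>UNIV. (x - a) $ i * partial_deriv i f (a + t *\<^sub>R (x - a))) has_integral
      f (a + 1 *\<^sub>R (x - a)) - f (a + 0 *\<^sub>R (x - a))) {0..1}"
    by (intro fundamental_theorem_of_calculus) auto
  moreover have "continuous_on {0..1} (\<lambda>t. partial_deriv i f (a + t *\<^sub>R (x - a)))" for i
    by (rule continuous_on_compose2[OF Cinf_continuous_on[OF partial, of UNIV]])
      (auto intro!: continuous_intros)
  \<comment> \<open>A second evaluation of the same integral, now term by term; comparing it with
    the value from the fundamental theorem yields the expansion.\<close>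
  then have "((\<lambda>t. \<Sum>i\<in>UNIV. (x - a) $ i * partial_deriv i f (a + t *\<^sub>R (x - a))) has_integral
      (\<Sum>i\<in>UNIV. (x - a) $ i * ?g i x)) {0..1}"
    by (intro has_integral_sum has_integral_mult_right integrable_integral
        integrable_continuous_real) auto
  ultimately have "f (a + 1 *\<^sub>R (x - a)) - f (a + 0 *\<^sub>R (x - a)) = (\<Sum>i\<in>UNIV. (x - a) $ i * ?g i x)"
    by (rule has_integral_unique)
  then show "f x = f a + (\<Sum>i\<in>UNIV. (x $ i - a $ i) * ?g i x)" by (simp add: algebra_simps)
qed

section \<open>Derivations on smooth functions\<close>

lemma linear_on_Cinf_sum:
  fixes f :: "'i \<Rightarrow> 'n::finite scalar_fun"
  assumes T: "linear_on_Cinf T" and f: "\<And>i. i \<in> I \<Longrightarrow> f i \<in> Cinf"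
  shows "T (\<lambda>x. \<Sum>i\<in>I. f i x) = (\<lambda>x. \<Sum>i\<in>I. T (f i) x)"
proof -
  have "\<And>c f. f \<in> Cinf \<Longrightarrow> T (\<lambda>x. c * f x) = (\<lambda>x. c * T f x)"
    using T by (simp add: linear_on_Cinf_def)
  \<comment> \<open>Homogeneity with scalar 0; this covers the empty sum, and also an infinite
    \<open>I\<close>, where the sum is 0 by convention.\<close>
  from this[OF Cinf_const, of 0] have "T (\<lambda>x. 0) = (\<lambda>x. 0)" by simp
  with f show ?thesis
  proof (induction I rule: infinite_finite_induct)
    case (insert i I)
    moreover have "T (\<lambda>x. f i x + (\<Sum>i\<in>I. f i x)) = (\<lambda>x. T (f i) x + T (\<lambda>x. \<Sum>i\<in>I. f i x) x)"
      using T insert.prems by (simp add: linear_on_Cinf_def Cinf_sum)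
    ultimately show ?case by simp
  qed simp_all
qed

text \<open>The Leibniz rule for 1 * 1 reads \<delta>(1) = 2 \<delta>(1), so \<delta>(1) = 0, and
  homogeneity extends this to all constants.\<close>

lemma derivation_on_Cinf_const:
  assumes "derivation_on_Cinf \<delta>"
  shows "\<delta> (\<lambda>x. c) = (\<lambda>x. 0)"
proof -
  have prod: "\<And>f g. f \<in> Cinf \<Longrightarrow> g \<in> Cinf \<Longrightarrow> \<delta> (\<lambda>x. f x * g x) = (\<lambda>x. f x * \<delta> g x + \<delta> f x * g x)"
    and scale: "\<And>c f. f \<in> Cinf \<Longrightarrow> \<delta> (\<lambda>x. c * f x) = (\<lambda>x. c * \<delta> f x)"
    using assms by (auto simp: derivation_on_Cinf_def linear_on_Cinf_def)
  have "\<delta> (\<lambda>x. 1) = (\<lambda>x. 0)"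
    using prod[OF Cinf_const[of 1] Cinf_const[of 1]] by (simp add: fun_eq_iff)
  then show ?thesis
    using scale[OF Cinf_const[of 1], of c] by simp
qed

lemma Cinf_coordinate: "(\<lambda>x. x $ i) \<in> Cinf"
  by (rule Cinf_bounded_linear) (rule bounded_linear_vec_nth)

text \<open>Apply \<delta> to the Hadamard expansion of \<open>f\<close> around \<open>a\<close> and
  evaluate at the same point \<open>a\<close>: the Leibniz terms that contain \<delta>(g_i) carry
  the factor \<open>x $ i - a $ i\<close>, which vanishes there.\<close>

lemma derivation_on_Cinf_eq:
  fixes \<delta> :: "'n::finite scalar_fun \<Rightarrow> 'n scalar_fun"
  assumes \<delta>: "derivation_on_Cinf \<delta>" and f: "f \<in> Cinf"
  shows "\<delta> f a = (\<Sum>i\<in>UNIV. \<delta> (\<lambda>x. x $ i) a * partial_deriv i f a)"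
proof -
  have lin: "linear_on_Cinf \<delta>"
    and prod: "\<And>u v. u \<in> Cinf \<Longrightarrow> v \<in> Cinf \<Longrightarrow> \<delta> (\<lambda>x. u x * v x) = (\<lambda>x. u x * \<delta> v x + \<delta> u x * v x)"
    using \<delta> by (auto simp: derivation_on_Cinf_def)
  have add: "\<And>u v. u \<in> Cinf \<Longrightarrow> v \<in> Cinf \<Longrightarrow> \<delta> (\<lambda>x. u x + v x) = (\<lambda>x. \<delta> u x + \<delta> v x)"
    using lin by (simp add: linear_on_Cinf_def)
  obtain g where g: "\<And>i. g i \<in> Cinf" and ga: "\<And>i. g i a = partial_deriv i f a"
    and fg: "\<And>x. f x = f a + (\<Sum>i\<in>UNIV. (x $ i - a $ i) * g i x)"
    using Hadamard[OF f] by blast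
  have shift: "(\<lambda>x. x $ i - a $ i) \<in> Cinf" for i
    using Cinf_add[OF Cinf_coordinate[of i] Cinf_const[of "- a $ i"]] by simp
  have "\<delta> (\<lambda>x. x $ i - a $ i) = \<delta> (\<lambda>x. x $ i)" for i
    using add[OF Cinf_coordinate[of i] Cinf_const[of "- a $ i"]]
    by (simp add: derivation_on_Cinf_const[OF \<delta>])
  then have "\<delta> (\<lambda>x. (x $ i - a $ i) * g i x) a = \<delta> (\<lambda>x. x $ i) a * partial_deriv i f a" for i
    by (simp add: prod[OF shift g] ga)
  moreover have "\<delta> (\<lambda>x. f a + (\<Sum>i\<in>UNIV. (x $ i - a $ i) * g i x)) a
      = (\<Sum>i\<in>UNIV. \<delta> (\<lambda>x. (x $ i - a $ i) * g i x) a)"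
    by (simp add: add Cinf_const Cinf_sum Cinf_mult shift g derivation_on_Cinf_const[OF \<delta>]
        linear_on_Cinf_sum[OF lin])
  moreover have "f = (\<lambda>x. f a + (\<Sum>i\<in>UNIV. (x $ i - a $ i) * g i x))"
    using fg by (rule ext)
  then have "\<delta> f a = \<delta> (\<lambda>x. f a + (\<Sum>i\<in>UNIV. (x $ i - a $ i) * g i x)) a"
    by (rule arg_cong[of _ _ "\<lambda>u. \<delta> u a"])
  ultimately show ?thesis by simp
qed

section \<open>Gradients and the four-linear form of a coefficient tensor\<close>

definition gradient :: "(real ^ 'n::finite \<Rightarrow> real) \<Rightarrow> real ^ 'n \<Rightarrow> real ^ 'n"
  where "gradient f x = (\<chi> i. partial_deriv i f x)"

lemma gradient_nth [simp]: "gradient f x $ i = partial_deriv i f x"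
  by (simp add: gradient_def)

lemma gradient_mult:
  assumes "f \<in> Cinf" "g \<in> Cinf"
  shows "gradient (\<lambda>x. f x * g x) x = f x *\<^sub>R gradient g x + g x *\<^sub>R gradient f x"
  using assms by (simp add: vec_eq_iff partial_deriv_mult Cinf_differentiable)

lemma gradient_inner [simp]: "gradient (\<lambda>x. u \<bullet> x) x = u"
  by (simp add: vec_eq_iff partial_deriv_linear bounded_linear_inner_right inner_axis)

lemma Cinf_inner: "(\<lambda>x. u \<bullet> x) \<in> Cinf"
  by (rule Cinf_bounded_linear) (rule bounded_linear_inner_right)

text \<open>The four-linear form on vectors with coefficient tensor \<open>c\<close>. Evaluated at
  gradients it is the right-hand side of the formula for \<open>e\<close>, so the conditions become
  linear algebra at a fixed point.\<close>

definition contract ::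
  "real ^ 'n::finite ^ 'n ^ 'n ^ 'n \<Rightarrow> real ^ 'n \<Rightarrow> real ^ 'n \<Rightarrow> real ^ 'n \<Rightarrow> real ^ 'n \<Rightarrow> real"
  where "contract c u v w z =
    (\<Sum>i\<in>UNIV. \<Sum>j\<in>UNIV. \<Sum>k\<in>UNIV. \<Sum>l\<in>UNIV. c $ i $ j $ k $ l * u $ i * v $ j * w $ k * z $ l)"

lemma contract_add:
  "contract c (u + u') v w z = contract c u v w z + contract c u' v w z"
  "contract c u (v + v') w z = contract c u v w z + contract c u v' w z"
  "contract c u v (w + w') z = contract c u v w z + contract c u v w' z"
  "contract c u v w (z + z') = contract c u v w z + contract c u v w z'"
  by (simp_all add: contract_def algebra_simps sum.distrib)

lemma contract_scaleR:
  "contract c (a *\<^sub>R u) v w z = a * contract c u v w z"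
  "contract c u (a *\<^sub>R v) w z = a * contract c u v w z"
  "contract c u v (a *\<^sub>R w) z = a * contract c u v w z"
  "contract c u v w (a *\<^sub>R z) = a * contract c u v w z"
  by (simp_all add: contract_def sum_distrib_left mult_ac)

lemma contract_axis:
  "contract c (axis i 1) (axis j 1) (axis k 1) (axis l 1) = c $ i $ j $ k $ l"
  by (simp add: contract_def axis_def mult_delta_left mult_delta_right)

lemma contract_swap:
  assumes "\<And>i j k l. c $ i $ j $ k $ l = c $ i $ j $ l $ k"
  shows "contract c u v w z = contract c u v z w"
proof -
  have "(\<Sum>k\<in>UNIV. \<Sum>l\<in>UNIV. c $ i $ j $ k $ l * u $ i * v $ j * w $ k * z $ l)
      = (\<Sum>k\<in>UNIV. \<Sum>l\<in>UNIV. c $ i $ j $ k $ l * u $ i * v $ j * z $ k * w $ l)" for i j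
    by (subst sum.swap) (simp add: assms[of i j] mult_ac)
  then show ?thesis by (simp add: contract_def)
qed

lemma sum_rotate:
  "(\<Sum>i\<in>A. \<Sum>k\<in>B. \<Sum>l\<in>C. F k l i) = (\<Sum>k\<in>B. \<Sum>l\<in>C. \<Sum>i\<in>A. F k l i)"
  by (simp add: sum.swap[of _ A B] sum.swap[of _ A C])

text \<open>For fixed j, the monomial \<open>u $ i * u $ k * u $ l\<close> is invariant under
  rotating (i, k, l). Adding the three rotated copies of the sum therefore gives three times the
  sum, while their coefficients add up to zero by \<open>cyc\<close>.\<close>

lemma contract_cyclic:
  assumes cyc: "\<And>i j k l. c $ i $ j $ k $ l + c $ k $ j $ l $ i + c $ l $ j $ i $ k = 0"
  shows "contract c u v u u = 0"
proof -
  define F where "F j i k l = c $ i $ j $ k $ l * u $ i * v $ j * u $ k * u $ l" for i j k l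
  define S where "S j = (\<Sum>i\<in>UNIV. \<Sum>k\<in>UNIV. \<Sum>l\<in>UNIV. F j i k l)" for j
  have "S j = 0" for j
  proof -
    have "F j i k l + F j k l i + F j l i k
        = (c $ i $ j $ k $ l + c $ k $ j $ l $ i + c $ l $ j $ i $ k) * (u $ i * v $ j * u $ k * u $ l)"
      for i k l by (simp add: F_def algebra_simps)
    then have "(\<Sum>i\<in>UNIV. \<Sum>k\<in>UNIV. \<Sum>l\<in>UNIV. F j i k l + F j k l i + F j l i k) = 0"
      by (simp add: cyc)
    then have "S j + (\<Sum>i\<in>UNIV. \<Sum>k\<in>UNIV. \<Sum>l\<in>UNIV. F j k l i)
        + (\<Sum>i\<in>UNIV. \<Sum>k\<in>UNIV. \<Sum>l\<in>UNIV. F j l i k) = 0"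
      by (simp add: S_def sum.distrib)
    moreover have "(\<Sum>i\<in>UNIV. \<Sum>k\<in>UNIV. \<Sum>l\<in>UNIV. F j k l i) = S j"
      unfolding S_def by (rule sum_rotate)
    moreover have "(\<Sum>i\<in>UNIV. \<Sum>k\<in>UNIV. \<Sum>l\<in>UNIV. F j l i k) = S j"
      unfolding S_def by (rule sum_rotate[symmetric])
    ultimately show ?thesis by simp
  qed
  then have "(\<Sum>j\<in>UNIV. S j) = 0" by simp
  then show ?thesis
    \<comment> \<open>\<open>contract\<close> sums over i outermost; the swap moves the sum over j
      outside.\<close>
    unfolding contract_def S_def F_def by (subst sum.swap)
qed

text \<open>Inclusion-exclusion for the cubic form u \<mapsto> \<open>contract c u v u u\<close>:
  its value at u + w + z, minus those at the pairwise sums, plus those at the single vectors, is the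
  sum over all six orders of u, w, z in slots 1, 3, 4. By \<open>swap\<close> these six terms are
  twice the three cyclic ones.\<close>

lemma contract_polarization:
  assumes swap: "\<And>u v w z. contract c u v w z = contract c u v z w"
    and diag: "\<And>u v. contract c u v u u = 0"
  shows "contract c u v w z + contract c w v z u + contract c z v u w = 0"
  using diag[of "u + w + z" v] diag[of "u + w" v] diag[of "u + z" v] diag[of "w + z" v]
    diag[of u v] diag[of w v] diag[of z v]
    swap[of u v z w] swap[of w v u z] swap[of z v w u]
    swap[of u v u w] swap[of u v u z] swap[of w v w u] swap[of w v w z] swap[of z v z u] swap[of z v z w]
  by (simp add: contract_add)

definition contract_matrix :: "real ^ 'n::finite ^ 'n ^ 'n ^ 'n \<Rightarrow> real ^ 'n \<Rightarrow> real ^ 'n ^ 'n"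
  where "contract_matrix c w = (\<chi> i j. \<Sum>k\<in>UNIV. \<Sum>l\<in>UNIV. c $ i $ j $ k $ l * w $ k * w $ l)"

lemma inner_contract_matrix: "u \<bullet> (contract_matrix c w *v v) = contract c u v w w"
  by (simp add: contract_matrix_def contract_def inner_vec_def matrix_vector_mult_def
      sum_distrib_left sum_distrib_right mult_ac)

text \<open>This restates symmetry through the bilinear form, so that it can be compared with
  symmetry of \<open>e\<close> in its first two arguments. Basis vectors recover the
  entries.\<close>

lemma symmetric_matrix_iff: "symmetric_matrix A \<longleftrightarrow> (\<forall>u v. u \<bullet> (A *v v) = v \<bullet> (A *v u))"
proof
  assume "symmetric_matrix A"
  then show "\<forall>u v. u \<bullet> (A *v v) = v \<bullet> (A *v u)"
    by (metis dot_lmul_matrix inner_commute symmetric_matrix_def transpose_matrix_vector)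
next
  assume *: "\<forall>u v. u \<bullet> (A *v v) = v \<bullet> (A *v u)"
  have "A $ i $ j = A $ j $ i" for i j
    using *[rule_format, of "axis i 1" "axis j 1"]
    by (simp add: inner_axis' matrix_vector_mult_basis column_def)
  then show "symmetric_matrix A"
    by (simp add: symmetric_matrix_def transpose_def vec_eq_iff)
qed

lemma symmetric_pos_semidef_contract_matrix:
  "symmetric_matrix (contract_matrix c w) \<and> pos_semidef_matrix (contract_matrix c w) \<longleftrightarrow>
    (\<forall>u v. contract c u v w w = contract c v u w w) \<and> (\<forall>u. contract c u u w w \<ge> 0)"
  by (simp add: symmetric_matrix_iff pos_semidef_matrix_def inner_contract_matrix)

section \<open>Four-derivations and their coefficient tensors\<close>

text \<open>The slots are expanded one after another. An expanded slot holds a coordinate function,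
  which is smooth, so \<open>e\<close> is still a derivation in the next slot.\<close>

lemma four_derivation_eq_contract:
  assumes e: "four_derivation e" and Cinf: "f \<in> Cinf" "s \<in> Cinf" "h \<in> Cinf" "q \<in> Cinf"
  shows "e f s h q x = contract
    (\<chi> i j k l. e (\<lambda>x. x $ i) (\<lambda>x. x $ j) (\<lambda>x. x $ k) (\<lambda>x. x $ l) x)
    (gradient f x) (gradient s x) (gradient h x) (gradient q x)"
proof -
  note X = Cinf_coordinate
  have der: "derivation_on_Cinf (\<lambda>u. e u a b c)" "derivation_on_Cinf (\<lambda>u. e a u b c)"
    "derivation_on_Cinf (\<lambda>u. e a b u c)" "derivation_on_Cinf (\<lambda>u. e a b c u)"
    if "a \<in> Cinf" "b \<in> Cinf" "c \<in> Cinf" for a b c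
    using e that by (auto simp: four_derivation_def in_each_argument_def)
  have "e f s h q x = (\<Sum>i\<in>UNIV. e (\<lambda>x. x $ i) s h q x * partial_deriv i f x)"
    by (rule derivation_on_Cinf_eq[OF der(1)]) (fact Cinf)+
  also have "\<dots> = (\<Sum>i\<in>UNIV. (\<Sum>j\<in>UNIV. e (\<lambda>x. x $ i) (\<lambda>x. x $ j) h q x * partial_deriv j s x)
      * partial_deriv i f x)"
    by (subst derivation_on_Cinf_eq[OF der(2)]) (auto intro: Cinf X)
  also have "\<dots> = (\<Sum>i\<in>UNIV. (\<Sum>j\<in>UNIV. (\<Sum>k\<in>UNIV.
      e (\<lambda>x. x $ i) (\<lambda>x. x $ j) (\<lambda>x. x $ k) q x * partial_deriv k h x)
      * partial_deriv j s x) * partial_deriv i f x)"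
    by (subst derivation_on_Cinf_eq[OF der(3)]) (auto intro: Cinf X)
  also have "\<dots> = (\<Sum>i\<in>UNIV. (\<Sum>j\<in>UNIV. (\<Sum>k\<in>UNIV. (\<Sum>l\<in>UNIV.
      e (\<lambda>x. x $ i) (\<lambda>x. x $ j) (\<lambda>x. x $ k) (\<lambda>x. x $ l) x * partial_deriv l q x)
      * partial_deriv k h x) * partial_deriv j s x) * partial_deriv i f x)"
    by (subst derivation_on_Cinf_eq[OF der(4)]) (auto intro: Cinf X)
  finally show ?thesis
    by (simp add: contract_def sum_distrib_left sum_distrib_right mult_ac)
qed

text \<open>Linearity comes from \<open>four_linear e\<close>. The Leibniz rule holds because the
  gradient of a product is f \<nabla>g + g \<nabla>f and \<open>contract\<close> is linear in each
  slot.\<close>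

lemma four_derivation_contract:
  assumes e: "four_linear e"
    and eq: "\<And>f s h q x. f \<in> Cinf \<Longrightarrow> s \<in> Cinf \<Longrightarrow> h \<in> Cinf \<Longrightarrow> q \<in> Cinf \<Longrightarrow>
      e f s h q x = contract (\<epsilon> x) (gradient f x) (gradient s x) (gradient h x) (gradient q x)"
  shows "four_derivation e"
  using e unfolding four_derivation_def four_linear_def in_each_argument_def derivation_on_Cinf_def
  by (simp add: fun_eq_iff eq Cinf_mult gradient_mult contract_add contract_scaleR mult.commute)

theorem proposition3p8:
  fixes e :: "'n::finite four_map"
  assumes "four_linear e"
  shows "(four_derivation e \<and>
          (\<forall>f\<in>Cinf. \<forall>s\<in>Cinf. \<forall>h\<in>Cinf. \<forall>q\<in>Cinf. e f s h q = e f s q h) \<and>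
          (\<forall>s\<in>Cinf. \<forall>h\<in>Cinf. e h s h h = (\<lambda>x. 0)) \<and>
          (\<forall>h\<in>Cinf. (\<forall>f\<in>Cinf. \<forall>s\<in>Cinf. e f s h h = e s f h h) \<and>
                    (\<forall>f\<in>Cinf. \<forall>x. e f f h h x \<ge> 0)))
     \<longleftrightarrow>
         (\<exists>\<epsilon> :: real ^ 'n \<Rightarrow> real ^ 'n ^ 'n ^ 'n ^ 'n.
            \<epsilon> \<in> Cinf \<and>
            (\<forall>i j k l. \<forall>x. \<epsilon> x $ i $ j $ k $ l = \<epsilon> x $ i $ j $ l $ k) \<and>
            (\<forall>i j k l. \<forall>x. \<epsilon> x $ i $ j $ k $ l + \<epsilon> x $ k $ j $ l $ i + \<epsilon> x $ l $ j $ i $ k = 0) \<and>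
            (\<forall>h\<in>Cinf. \<forall>x.
               let A = (\<chi> i j. \<Sum>k\<in>UNIV. \<Sum>l\<in>UNIV.
                          \<epsilon> x $ i $ j $ k $ l * partial_deriv k h x * partial_deriv l h x)
               in symmetric_matrix A \<and> pos_semidef_matrix A) \<and>
            (\<forall>f\<in>Cinf. \<forall>s\<in>Cinf. \<forall>h\<in>Cinf. \<forall>q\<in>Cinf. \<forall>x.
               e f s h q x =
                 (\<Sum>i\<in>UNIV. \<Sum>j\<in>UNIV. \<Sum>k\<in>UNIV. \<Sum>l\<in>UNIV.
                    \<epsilon> x $ i $ j $ k $ l * partial_deriv i f x * partial_deriv j s x
                      * partial_deriv k h x * partial_deriv l q x)))"
    (is "?derivation \<and> ?swap \<and> ?diag \<and> ?psd \<longleftrightarrow> (\<exists>\<epsilon>. ?P \<epsilon>)")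
proof
  have matrix: "(\<chi> i j. \<Sum>k\<in>UNIV. \<Sum>l\<in>UNIV.
      \<epsilon> x $ i $ j $ k $ l * partial_deriv k h x * partial_deriv l h x) = contract_matrix (\<epsilon> x) (gradient h x)"
    for \<epsilon> :: "real ^ 'n \<Rightarrow> real ^ 'n ^ 'n ^ 'n ^ 'n" and h x
    by (simp add: contract_matrix_def)
  have formula: "(\<Sum>i\<in>UNIV. \<Sum>j\<in>UNIV. \<Sum>k\<in>UNIV. \<Sum>l\<in>UNIV. \<epsilon> x $ i $ j $ k $ l * partial_deriv i f x
      * partial_deriv j s x * partial_deriv k h x * partial_deriv l q x)
      = contract (\<epsilon> x) (gradient f x) (gradient s x) (gradient h x) (gradient q x)"
    for \<epsilon> :: "real ^ 'n \<Rightarrow> real ^ 'n ^ 'n ^ 'n ^ 'n" and f s h q x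
    by (simp add: contract_def)
  note contract_simps = matrix formula Let_def symmetric_pos_semidef_contract_matrix
  {
    assume "?derivation \<and> ?swap \<and> ?diag \<and> ?psd"
    then have e: ?derivation and swap: ?swap and diag: ?diag and psd: ?psd by blast+
    define \<epsilon> :: "real ^ 'n \<Rightarrow> real ^ 'n ^ 'n ^ 'n ^ 'n"
      where "\<epsilon> x = (\<chi> i j k l. e (\<lambda>x. x $ i) (\<lambda>x. x $ j) (\<lambda>x. x $ k) (\<lambda>x. x $ l) x)" for x
    have eq: "e f s h q x
        = contract (\<epsilon> x) (gradient f x) (gradient s x) (gradient h x) (gradient q x)"
      if "f \<in> Cinf" "s \<in> Cinf" "h \<in> Cinf" "q \<in> Cinf" for f s h q x
      using four_derivation_eq_contract[OF e that] by (simp add: \<epsilon>_def)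
    have "e f s h q \<in> Cinf" if "f \<in> Cinf" "s \<in> Cinf" "h \<in> Cinf" "q \<in> Cinf" for f s h q
      using assms that by (simp add: four_linear_def in_each_argument_def linear_on_Cinf_def)
    then have "\<epsilon> \<in> Cinf"
      unfolding \<epsilon>_def by (intro Cinf_vec_lambda) (simp add: Cinf_coordinate)
    moreover have \<epsilon>_swap: "\<epsilon> x $ i $ j $ k $ l = \<epsilon> x $ i $ j $ l $ k" for x i j k l
    proof -
      have "e (\<lambda>x. x $ i) (\<lambda>x. x $ j) (\<lambda>x. x $ k) (\<lambda>x. x $ l)
          = e (\<lambda>x. x $ i) (\<lambda>x. x $ j) (\<lambda>x. x $ l) (\<lambda>x. x $ k)"
        using swap Cinf_coordinate by blast
      then show ?thesis by (simp add: \<epsilon>_def)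
    qed
    moreover have "\<epsilon> x $ i $ j $ k $ l + \<epsilon> x $ k $ j $ l $ i + \<epsilon> x $ l $ j $ i $ k = 0" for x i j k l
    proof -
      \<comment> \<open>The linear functions with gradients \<open>u\<close> and \<open>v\<close>
        are inserted into (iii); the cubic form thus vanishes at every vector.\<close>
      have "contract (\<epsilon> x) u v u u = 0" for u v
        using diag eq[OF Cinf_inner Cinf_inner Cinf_inner Cinf_inner, of u v u u x]
        by (simp add: Cinf_inner)
      \<comment> \<open>On basis vectors the polarized identity is exactly the cyclic relation (b)
        between entries.\<close>
      from contract_polarization[OF contract_swap[OF \<epsilon>_swap] this,
          of "axis i 1" "axis j 1" "axis k 1" "axis l 1"]
      show ?thesis by (simp add: contract_axis)
    qed
    \<comment> \<open>Only the first two arguments are specialised to linear functions: (c), like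
      (iv), is stated for each smooth \<open>h\<close>, while \<open>u\<close> and \<open>v\<close>
      range over all vectors that test the matrix.\<close>
    moreover have "contract (\<epsilon> x) u v (gradient h x) (gradient h x)
        = contract (\<epsilon> x) v u (gradient h x) (gradient h x)"
      and "contract (\<epsilon> x) u u (gradient h x) (gradient h x) \<ge> 0" if h: "h \<in> Cinf" for h x u v
    proof -
      note eq_inner = eq[OF Cinf_inner Cinf_inner h h, where x = x, unfolded gradient_inner]
      have "e (\<lambda>x. u \<bullet> x) (\<lambda>x. v \<bullet> x) h h = e (\<lambda>x. v \<bullet> x) (\<lambda>x. u \<bullet> x) h h"
        using psd h Cinf_inner by blast
      then show "contract (\<epsilon> x) u v (gradient h x) (gradient h x)
          = contract (\<epsilon> x) v u (gradient h x) (gradient h x)"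
        using eq_inner[of u v] eq_inner[of v u] by simp
      have "e (\<lambda>x. u \<bullet> x) (\<lambda>x. u \<bullet> x) h h x \<ge> 0"
        using psd h Cinf_inner by blast
      then show "contract (\<epsilon> x) u u (gradient h x) (gradient h x) \<ge> 0"
        using eq_inner[of u u] by simp
    qed
    ultimately show "\<exists>\<epsilon>. ?P \<epsilon>"
      unfolding contract_simps using eq by (intro exI[of _ \<epsilon>] conjI allI ballI)
  next
    assume "\<exists>\<epsilon>. ?P \<epsilon>"
    then obtain \<epsilon> where "?P \<epsilon>" ..
    then have swap: "\<And>x i j k l. \<epsilon> x $ i $ j $ k $ l = \<epsilon> x $ i $ j $ l $ k"
      and cyc: "\<And>x i j k l. \<epsilon> x $ i $ j $ k $ l + \<epsilon> x $ k $ j $ l $ i + \<epsilon> x $ l $ j $ i $ k = 0"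
      and sym: "\<And>h x u v. h \<in> Cinf \<Longrightarrow> contract (\<epsilon> x) u v (gradient h x) (gradient h x)
          = contract (\<epsilon> x) v u (gradient h x) (gradient h x)"
      and pos: "\<And>h x u. h \<in> Cinf \<Longrightarrow> contract (\<epsilon> x) u u (gradient h x) (gradient h x) \<ge> 0"
      and eq: "\<And>f s h q x. f \<in> Cinf \<Longrightarrow> s \<in> Cinf \<Longrightarrow> h \<in> Cinf \<Longrightarrow> q \<in> Cinf \<Longrightarrow> e f s h q x
          = contract (\<epsilon> x) (gradient f x) (gradient s x) (gradient h x) (gradient q x)"
      unfolding contract_simps by blast+
    show "?derivation \<and> ?swap \<and> ?diag \<and> ?psd"
    proof (intro conjI ballI allI)
      show ?derivation by (rule four_derivation_contract[OF assms eq])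
    \<comment> \<open>After rewriting by \<open>eq\<close>, (ii) follows from (a) by
      \<open>contract_swap\<close>, (iii) from (b) by \<open>contract_cyclic\<close>, and (iv) from
      (c) with the gradients as test vectors.\<close>
    qed (auto simp: fun_eq_iff eq contract_cyclic[OF cyc] pos intro: sym contract_swap[OF swap])
  }
qed

end
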